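(* Let $E$ and $F$ be Archimedean Riesz spaces, and let $F^{\delta}$ be an order completion of $F$ with corresponding bipositive linear map $i:F\to F^{\delta}$. If $F$ is atomic, then $\mathcal{L}^r(E,F)$ is pervasive in $\mathcal{L}^r(E,F^{\delta})$; that is, for every $T\in\mathcal{L}^r(E,F^{\delta})$ with $T>0$ there is $S\in\mathcal{L}^r(E,i(F))$ with $0<S\le T$.
   Context: Riesz space = vector lattice. $\mathcal{L}^r(E,F)$ is the space of regular operators (differences of positive linear operators) $E\to F$, ordered by $S\le T$ iff $S(x)\le T(x)$ for all $x\in E_+$. Order completion: an order complete Riesz space $F^{\delta}$ with a linear bipositive map $i:F\to F^{\delta}$ ($x\ge0$ iff $i(x)\ge0$) such that $i(F)$ is majorizing (every element of $F^\delta$ lies below some element of $i(F)$) and pervasive in $F^{\delta}$ (for every $0<x\in F^\delta$ there is $y\in i(F)$ with $0<y\le x$). $\mathcal{L}^r(E,i(F))$ is regarded as a subspace of $\mathcal{L}^r(E,F^{\delta})$. An element $e\in X_+$ of an Archimedean Riesz space $X$ is an atom if $0\le x\le e$ implies that $x$ is a scalar multiple of $e$. A family $\{e_i\mid i\in I\}$ is a complete disjoint system if $e_i>0$ for each $i$, $e_i\wedge e_j=0$ for $i\ne j$, and $x\wedge e_i=0$ for all $i\in I$ implies $x=0$. $X$ is atomic if it has a complete disjoint system consisting of atoms. *)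

theory Defs
  imports Complex_Main
begin

class riesz_space = ordered_real_vector + lattice

class archimedean_riesz_space = riesz_space +
  assumes archimedean: "(\<And>n::nat. of_nat n *\<^sub>R x \<le> y) \<Longrightarrow> x \<le> 0"

class order_complete_riesz_space = riesz_space + conditionally_complete_lattice

definition is_majorizing :: "'a::riesz_space set \<Rightarrow> bool" where
  "is_majorizing M \<longleftrightarrow> (\<forall>x. \<exists>y\<in>M. x \<le> y)"

definition is_pervasive :: "'a::riesz_space set \<Rightarrow> bool" where
  "is_pervasive M \<longleftrightarrow> (\<forall>x>0. \<exists>y\<in>M. 0 < y \<and> y \<le> x)"

definition bipositive :: "('a::riesz_space \<Rightarrow> 'b::riesz_space) \<Rightarrow> bool" where
  "bipositive i \<longleftrightarrow> (\<forall>x. 0 \<le> x \<longleftrightarrow> 0 \<le> i x)"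

definition order_completion :: "('f::riesz_space \<Rightarrow> 'd::order_complete_riesz_space) \<Rightarrow> bool" where
  "order_completion i \<longleftrightarrow>
     linear i \<and> bipositive i \<and> is_majorizing (range i) \<and> is_pervasive (range i)"

definition atom :: "'a::archimedean_riesz_space \<Rightarrow> bool" where
  "atom e \<longleftrightarrow> 0 \<le> e \<and> (\<forall>x. 0 \<le> x \<and> x \<le> e \<longrightarrow> (\<exists>c::real. x = c *\<^sub>R e))"

definition complete_disjoint_system :: "'i set \<Rightarrow> ('i \<Rightarrow> 'a::riesz_space) \<Rightarrow> bool" where
  "complete_disjoint_system I e \<longleftrightarrow>
     (\<forall>i\<in>I. 0 < e i) \<and>
     (\<forall>i\<in>I. \<forall>j\<in>I. i \<noteq> j \<longrightarrow> inf (e i) (e j) = 0) \<and>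
     (\<forall>x. (\<forall>i\<in>I. inf x (e i) = 0) \<longrightarrow> x = 0)"

text \<open>A complete disjoint system is an injective family (if \<open>e i = e j\<close> with \<open>i \<noteq> j\<close> then
  \<open>e i = inf (e i) (e j) = 0\<close>), so index sets within the space itself cover all cases.\<close>

definition atomic :: "'a::archimedean_riesz_space itself \<Rightarrow> bool" where
  "atomic _ \<longleftrightarrow>
     (\<exists>(I :: 'a set) (e :: 'a \<Rightarrow> 'a). complete_disjoint_system I e \<and> (\<forall>i\<in>I. atom (e i)))"

definition positive_operator :: "('e::riesz_space \<Rightarrow> 'g::riesz_space) \<Rightarrow> bool" where
  "positive_operator T \<longleftrightarrow> linear T \<and> (\<forall>x\<ge>0. 0 \<le> T x)"

text \<open>Regular operators into a subspace \<open>Y\<close> of the codomain: both positive parts must take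
  their values in \<open>Y\<close>. The full space of regular operators is the case \<open>Y = UNIV\<close>.\<close>

definition regular_operators :: "'g::riesz_space set \<Rightarrow> ('e::riesz_space \<Rightarrow> 'g) set" where
  "regular_operators Y =
     {T. \<exists>A B. positive_operator A \<and> positive_operator B \<and>
               range A \<subseteq> Y \<and> range B \<subseteq> Y \<and> T = (\<lambda>x. A x - B x)}"

text \<open>The operator order only compares values on the positive cone, unlike the pointwise
  order \<open>\<le>\<close> on functions.\<close>

definition op_le :: "('e::riesz_space \<Rightarrow> 'g::riesz_space) \<Rightarrow> ('e \<Rightarrow> 'g) \<Rightarrow> bool" where
  "op_le S T \<longleftrightarrow> (\<forall>x\<ge>0. S x \<le> T x)"

definition op_less :: "('e::riesz_space \<Rightarrow> 'g::riesz_space) \<Rightarrow> ('e \<Rightarrow> 'g) \<Rightarrow> bool" where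
  "op_less S T \<longleftrightarrow> op_le S T \<and> S \<noteq> T"

end

theory Submission
  imports Defs "HOL-Library.Lattice_Algebras"
begin

text \<open>
  A positive atom \<open>a\<close> of an Archimedean Riesz space \<open>X\<close> splits \<open>X\<close> into the line spanned by \<open>a\<close>
  and its disjoint complement. The coordinate of a positive \<open>z\<close> along \<open>a\<close> is the largest
  \<open>t\<close> with \<open>t *\<^sub>R a \<le> z\<close>; it is additive because, by Riesz decomposition, a multiple of \<open>a\<close>
  below \<open>z + w\<close> is a sum of one below \<open>z\<close> and one below \<open>w\<close>. So it extends to a positive
  linear functional \<open>\<phi>\<close> with \<open>\<phi> z *\<^sub>R a \<le> z\<close> for all positive \<open>z\<close> (lemma
  \<open>atom_functional_exists\<close>). For a positive operator \<open>T\<close> into \<open>X\<close>, the operator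
  \<open>x \<mapsto> \<phi> (T x) *\<^sub>R a\<close> is then positive, lies below \<open>T\<close>, and takes values in the line
  through \<open>a\<close>.

  To land in \<open>i(F)\<close> it is enough to use an atom of the completion \<open>F\<^sup>\<delta>\<close> that lies in \<open>i(F)\<close>. If
  \<open>T > 0\<close> then \<open>T x > 0\<close> for some positive \<open>x\<close>; pervasiveness puts some \<open>i y > 0\<close> below \<open>T x\<close>,
  and as \<open>F\<close> is atomic there is an atom \<open>e > 0\<close> below \<open>y\<close>
  (lemma \<open>atomic_positive_atom_below\<close>). A bipositive map with pervasive range sends atoms to
  atoms (lemma \<open>bipositive_pervasive_atom_image\<close>), so \<open>a = i e\<close> is an atom below \<open>T x\<close>. The
  operator above has a positive value at \<open>x\<close>, hence is not zero.
\<close>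

instance riesz_space \<subseteq> lattice_ab_group_add ..

text \<open>If \<open>s\<close> is the supremum of the multiples \<open>n *\<^sub>R x\<close>, then \<open>s - x\<close> is again an upper bound
  of them.\<close>

instance order_complete_riesz_space \<subseteq> archimedean_riesz_space
proof
  fix x y :: 'a
  assume bound: "\<And>n::nat. of_nat n *\<^sub>R x \<le> y"
  let ?M = "range (\<lambda>n::nat. of_nat n *\<^sub>R x)"
  have bdd: "bdd_above ?M"
    using bound by (auto simp: bdd_above_def)
  have "Sup ?M \<le> Sup ?M - x"
  proof (rule cSup_least)
    fix m assume "m \<in> ?M"
    then obtain n :: nat where m: "m = of_nat n *\<^sub>R x"
      by auto
    have "of_nat (Suc n) *\<^sub>R x \<le> Sup ?M"
      by (rule cSup_upper[OF _ bdd]) blast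
    then show "m \<le> Sup ?M - x"
      unfolding m by (simp add: algebra_simps)
  qed simp
  then show "x \<le> 0"
    by (simp add: algebra_simps)
qed

section \<open>Extension from the positive cone\<close>

text \<open>Every \<open>x\<close> is a difference of positive elements, so a linear extension has only one
  possible value at \<open>x\<close>. Additivity on the cone makes that value independent of the chosen
  difference, and linearity follows by choosing convenient differences.\<close>

lemma positive_cone_linear_extension:
  fixes g :: "'a::riesz_space \<Rightarrow> 'b::real_vector"
  assumes add: "\<And>x y. 0 \<le> x \<Longrightarrow> 0 \<le> y \<Longrightarrow> g (x + y) = g x + g y"
    and scale: "\<And>c x. 0 \<le> c \<Longrightarrow> 0 \<le> x \<Longrightarrow> g (c *\<^sub>R x) = c *\<^sub>R g x"
  shows "\<exists>f. linear f \<and> (\<forall>x\<ge>0. f x = g x)"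
proof -
  define f where "f = (\<lambda>x. g (pprt x) - g (- nprt x))"
  have f_diff: "f (u - v) = g u - g v" if "0 \<le> u" "0 \<le> v" for u v
  proof -
    let ?x = "u - v"
    have nonneg: "0 \<le> pprt ?x" "0 \<le> - nprt ?x"
      by simp_all
    have "u - v = pprt ?x + nprt ?x"
      by (rule prts)
    then have "pprt ?x + v = u + - nprt ?x"
      by (simp add: algebra_simps)
    then have "g (pprt ?x) + g v = g u + g (- nprt ?x)"
      using add nonneg that by metis
    then show ?thesis
      unfolding f_def by (simp add: algebra_simps)
  qed
  have g0: "g 0 = 0"
    using scale[of 0 0] by simp
  have decomp: "\<exists>u v. 0 \<le> u \<and> 0 \<le> v \<and> x = u - v" for x :: 'a
    by (rule exI[of _ "pprt x"], rule exI[of _ "- nprt x"]) (simp add: prts[symmetric])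
  have "linear f"
  proof (rule linearI)
    fix x y :: 'a
    obtain u v where x: "0 \<le> u" "0 \<le> v" "x = u - v" using decomp by blast
    obtain u' v' where y: "0 \<le> u'" "0 \<le> v'" "y = u' - v'" using decomp by blast
    have "x + y = (u + u') - (v + v')"
      using x y by simp
    then have "f (x + y) = g (u + u') - g (v + v')"
      using x y by (simp only: f_diff add_nonneg_nonneg)
    then show "f (x + y) = f x + f y"
      using x y by (simp add: f_diff add)
  next
    fix c :: real and x :: 'a
    obtain u v where x: "0 \<le> u" "0 \<le> v" "x = u - v" using decomp by blast
    show "f (c *\<^sub>R x) = c *\<^sub>R f x"
    proof (cases "0 \<le> c")
      case True
      have "c *\<^sub>R x = c *\<^sub>R u - c *\<^sub>R v"
        using x by (simp add: scaleR_diff_right)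
      then show ?thesis
        using x True by (simp add: f_diff scale scaleR_nonneg_nonneg scaleR_diff_right)
    next
      case False
      have "c *\<^sub>R x = (- c) *\<^sub>R v - (- c) *\<^sub>R u"
        by (simp add: x(3) scaleR_diff_right)
      moreover have "0 \<le> (- c) *\<^sub>R v" "0 \<le> (- c) *\<^sub>R u"
        using x False by (intro scaleR_nonneg_nonneg; simp)+
      ultimately have "f (c *\<^sub>R x) = (- c) *\<^sub>R g v - (- c) *\<^sub>R g u"
        using x False by (simp only: f_diff scale neg_0_le_iff_le nle_le)
      moreover have "f x = g u - g v"
        using x by (simp add: f_diff)
      ultimately show ?thesis
        by (simp add: scaleR_diff_right)
    qed
  qed
  moreover have "f x = g x" if "0 \<le> x" for x
    using f_diff[of x 0] that g0 by simp
  ultimately show ?thesis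
    by blast
qed

lemma riesz_decomposition:
  fixes x y z :: "'a::riesz_space"
  assumes "0 \<le> x" "0 \<le> y" "0 \<le> z" "x \<le> y + z"
  obtains u v where "x = u + v" "0 \<le> u" "u \<le> y" "0 \<le> v" "v \<le> z"
proof
  show "x = inf x y + (x - inf x y)" by (metis add.commute diff_add_cancel)
  show "0 \<le> inf x y" "inf x y \<le> y" "0 \<le> x - inf x y"
    using assms by (simp_all only: le_inf_iff inf_le2 diff_ge_0_iff_ge inf_le1)
  have "x - z \<le> inf x y"
    using assms by (simp add: algebra_simps)
  then show "x - inf x y \<le> z"
    by (metis diff_le_eq add.commute)
qed

section \<open>The coordinate along a positive element\<close>

definition coefficient :: "'a::riesz_space \<Rightarrow> 'a \<Rightarrow> real" where
  "coefficient a z = Sup {t. t *\<^sub>R a \<le> z}"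

text \<open>The supremum is attained: if \<open>s\<close> is the supremum, then \<open>s *\<^sub>R a - z\<close> is below every
  positive multiple of \<open>a\<close>, hence not positive by the Archimedean property.\<close>

lemma scaleR_le_iff_le_coefficient:
  fixes a z :: "'a::archimedean_riesz_space"
  assumes a: "0 < a" and z: "0 \<le> z"
  shows "t *\<^sub>R a \<le> z \<longleftrightarrow> t \<le> coefficient a z"
proof -
  let ?M = "{t. t *\<^sub>R a \<le> z}"
  have a0: "0 \<le> a" using a by simp
  have down: "s *\<^sub>R a \<le> z" if "s \<le> t" "t *\<^sub>R a \<le> z" for s t
    using scaleR_right_mono[OF that(1) a0] that(2) by (rule order_trans)
  have "0 \<in> ?M" using z by simp
  then have ne: "?M \<noteq> {}" by blast
  have "\<exists>n::nat. \<not> of_nat n *\<^sub>R a \<le> z"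
    using archimedean[of a z] a by (meson not_le leD)
  then obtain n :: nat where n: "\<not> of_nat n *\<^sub>R a \<le> z" ..
  have bdd: "bdd_above ?M"
  proof (rule bdd_aboveI)
    fix t assume "t \<in> ?M"
    then show "t \<le> of_nat n" using n down[of "of_nat n" t] by force
  qed
  have "coefficient a z *\<^sub>R a - z \<le> 0"
  proof (rule archimedean)
    fix m :: nat
    show "of_nat m *\<^sub>R (coefficient a z *\<^sub>R a - z) \<le> a"
    proof (cases "m = 0")
      case True
      then show ?thesis using a0 by simp
    next
      case False
      then have m: "0 < real m" by simp
      have "coefficient a z - 1 / real m < Sup ?M"
        using m by (simp add: coefficient_def)
      then obtain t where "t \<in> ?M" "coefficient a z - 1 / real m < t"
        using less_cSup_iff[OF ne bdd] by blast
      then have "(coefficient a z - 1 / real m) *\<^sub>R a \<le> z"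
        using down[of "coefficient a z - 1 / real m" t] by auto
      then have "real m *\<^sub>R ((coefficient a z - 1 / real m) *\<^sub>R a) \<le> real m *\<^sub>R z"
        using m by (intro scaleR_left_mono) simp_all
      moreover have "real m * (coefficient a z - 1 / real m) = real m * coefficient a z - 1"
        using m by (simp add: field_simps)
      ultimately show ?thesis
        by (simp add: algebra_simps)
    qed
  qed
  then have "coefficient a z *\<^sub>R a \<le> z" by simp
  then show ?thesis
    using down cSup_upper[OF _ bdd, of t] by (auto simp: coefficient_def)
qed

lemma coefficient_nonneg:
  fixes a z :: "'a::archimedean_riesz_space"
  assumes "0 < a" "0 \<le> z"
  shows "0 \<le> coefficient a z"
  using scaleR_le_iff_le_coefficient[OF assms, of 0] assms by simp

lemma coefficient_scaleR:
  fixes a z :: "'a::archimedean_riesz_space"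
  assumes a: "0 < a" and z: "0 \<le> z" and c: "0 < c"
  shows "coefficient a (c *\<^sub>R z) = c * coefficient a z"
proof -
  have cz: "0 \<le> c *\<^sub>R z" using z c by (simp add: scaleR_nonneg_nonneg)
  have "t \<le> coefficient a (c *\<^sub>R z) \<longleftrightarrow> t \<le> c * coefficient a z" for t
  proof -
    have "t *\<^sub>R a \<le> c *\<^sub>R z \<longleftrightarrow> (t / c) *\<^sub>R a \<le> z"
    proof
      assume "t *\<^sub>R a \<le> c *\<^sub>R z"
      then have "(1 / c) *\<^sub>R (t *\<^sub>R a) \<le> (1 / c) *\<^sub>R (c *\<^sub>R z)"
        using c by (intro scaleR_left_mono) simp_all
      then show "(t / c) *\<^sub>R a \<le> z" using c by simp
    next
      assume "(t / c) *\<^sub>R a \<le> z"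
      then have "c *\<^sub>R ((t / c) *\<^sub>R a) \<le> c *\<^sub>R z"
        using c by (intro scaleR_left_mono) simp_all
      then show "t *\<^sub>R a \<le> c *\<^sub>R z" using c by simp
    qed
    then have "t \<le> coefficient a (c *\<^sub>R z) \<longleftrightarrow> t / c \<le> coefficient a z"
      by (simp only: scaleR_le_iff_le_coefficient[OF a z] scaleR_le_iff_le_coefficient[OF a cz])
    then show ?thesis
      using c by (simp add: pos_divide_le_eq mult.commute)
  qed
  then show ?thesis
    by (metis order_antisym order_refl)
qed

section \<open>Atoms\<close>

text \<open>For a general \<open>a\<close> the coefficient is only superadditive. For an atom, the Riesz
  decomposition of \<open>coefficient a (z + w) *\<^sub>R a\<close> consists of multiples of \<open>a\<close>.\<close>

lemma coefficient_add:
  fixes a z w :: "'a::archimedean_riesz_space"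
  assumes atom: "atom a" and a: "0 < a" and z: "0 \<le> z" and w: "0 \<le> w"
  shows "coefficient a (z + w) = coefficient a z + coefficient a w"
proof (rule order_antisym)
  note le_iff = scaleR_le_iff_le_coefficient[OF a]
  have zw: "0 \<le> z + w" using z w by simp
  have "coefficient a z *\<^sub>R a + coefficient a w *\<^sub>R a \<le> z + w"
    using z w by (intro add_mono) (simp_all add: le_iff)
  then show "coefficient a z + coefficient a w \<le> coefficient a (z + w)"
    by (simp add: le_iff[OF zw, symmetric] scaleR_add_left)
  define s where "s = coefficient a (z + w)"
  have s: "0 \<le> s" unfolding s_def by (rule coefficient_nonneg[OF a zw])
  have "0 \<le> s *\<^sub>R a" using s a by (simp add: scaleR_nonneg_nonneg)
  moreover have "s *\<^sub>R a \<le> z + w" by (simp add: le_iff[OF zw] s_def)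
  ultimately obtain u v
    where uv: "s *\<^sub>R a = u + v" "0 \<le> u" "u \<le> z" "0 \<le> v" "v \<le> w"
    using riesz_decomposition z w by metis
  have multiple: "\<exists>c. x = c *\<^sub>R a" if x: "0 \<le> x" "x \<le> s *\<^sub>R a" for x
  proof (cases "s = 0")
    case True
    then have "x = 0 *\<^sub>R a" using x by simp
    then show ?thesis ..
  next
    case False
    then have pos: "0 < s" using s by simp
    have "(1 / s) *\<^sub>R x \<le> (1 / s) *\<^sub>R (s *\<^sub>R a)"
      using pos x by (intro scaleR_left_mono) simp_all
    then have "(1 / s) *\<^sub>R x \<le> a" using pos by simp
    moreover have "0 \<le> (1 / s) *\<^sub>R x" using pos x by (simp add: scaleR_nonneg_nonneg)
    ultimately obtain c where "(1 / s) *\<^sub>R x = c *\<^sub>R a"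
      using atom unfolding atom_def by blast
    then have "s *\<^sub>R ((1 / s) *\<^sub>R x) = s *\<^sub>R (c *\<^sub>R a)" by simp
    then have "x = (s * c) *\<^sub>R a" using pos by simp
    then show ?thesis ..
  qed
  obtain b where b: "u = b *\<^sub>R a" using multiple[of u] uv by auto
  obtain c where c: "v = c *\<^sub>R a" using multiple[of v] uv by auto
  have "s *\<^sub>R a = (b + c) *\<^sub>R a"
    using uv b c by (simp add: scaleR_add_left)
  then have "s = b + c" using a by auto
  moreover have "b \<le> coefficient a z" "c \<le> coefficient a w"
    using uv b c z w by (simp_all add: le_iff[symmetric])
  ultimately show "coefficient a (z + w) \<le> coefficient a z + coefficient a w"
    unfolding s_def by linarith
qed

text \<open>The map \<open>\<lambda>z. \<phi> z *\<^sub>R a\<close> is the band projection onto the line through \<open>a\<close>. The clause on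
  \<open>t\<close> ensures that \<open>\<phi>\<close> is not zero.\<close>

lemma atom_functional_exists:
  fixes a :: "'a::archimedean_riesz_space"
  assumes atom: "atom a" and a: "0 < a"
  obtains \<phi> :: "'a \<Rightarrow> real"
  where "linear \<phi>" "\<And>z. 0 \<le> z \<Longrightarrow> 0 \<le> \<phi> z" "\<And>z. 0 \<le> z \<Longrightarrow> \<phi> z *\<^sub>R a \<le> z"
    "\<And>t z. 0 \<le> z \<Longrightarrow> t *\<^sub>R a \<le> z \<Longrightarrow> t \<le> \<phi> z"
proof -
  have zero: "coefficient a 0 = 0"
    using coefficient_add[OF atom a, of 0 0] by simp
  have "\<exists>\<phi>. linear \<phi> \<and> (\<forall>z\<ge>0. \<phi> z = coefficient a z)"
  proof (rule positive_cone_linear_extension)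
    fix c :: real and z :: 'a
    assume "0 \<le> c" "0 \<le> z"
    then show "coefficient a (c *\<^sub>R z) = c *\<^sub>R coefficient a z"
      by (cases "c = 0") (simp_all add: zero coefficient_scaleR[OF a])
  qed (rule coefficient_add[OF atom a])
  then obtain \<phi> where \<phi>: "linear \<phi>" "\<And>z. 0 \<le> z \<Longrightarrow> \<phi> z = coefficient a z"
    by blast
  show thesis
    by (rule that[of \<phi>])
      (simp_all add: \<phi> coefficient_nonneg[OF a] scaleR_le_iff_le_coefficient[OF a])
qed

text \<open>Some member \<open>e\<close> of the complete disjoint system meets \<open>y\<close>; the atom is \<open>inf y e\<close>, which is
  a nonzero multiple of \<open>e\<close>.\<close>

lemma atomic_positive_atom_below:
  fixes y :: "'a::archimedean_riesz_space"
  assumes "atomic TYPE('a)" and y: "0 < y"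
  obtains w where "atom w" "0 < w" "w \<le> y"
proof -
  obtain I :: "'a set" and e :: "'a \<Rightarrow> 'a" where sys: "complete_disjoint_system I e"
    and atoms: "\<And>k. k \<in> I \<Longrightarrow> atom (e k)"
    using assms(1) unfolding atomic_def by blast
  obtain k where k: "k \<in> I" "inf y (e k) \<noteq> 0"
    using sys y unfolding complete_disjoint_system_def by (metis less_irrefl)
  define w where "w = inf y (e k)"
  have ek: "0 \<le> e k" using atoms[OF k(1)] unfolding atom_def by blast
  then have w: "0 < w" "w \<le> y" "w \<le> e k"
    using y k(2) unfolding w_def by (simp_all add: less_le)
  have multiple: "\<exists>c. x = c *\<^sub>R e k" if "0 \<le> x" "x \<le> w" for x
    using atoms[OF k(1)] that w(3) unfolding atom_def by (meson order_trans)
  obtain d where d: "w = d *\<^sub>R e k"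
    using multiple[of w] w(1) by (auto simp: less_imp_le)
  have "d \<noteq> 0" using d w(1) by auto
  have "atom w"
    unfolding atom_def
  proof (intro conjI allI impI)
    show "0 \<le> w" using w(1) by simp
    fix x assume "0 \<le> x \<and> x \<le> w"
    then obtain c where "x = c *\<^sub>R e k" using multiple by blast
    then have "x = (c / d) *\<^sub>R w" using d \<open>d \<noteq> 0\<close> by simp
    then show "\<exists>c. x = c *\<^sub>R w" ..
  qed
  then show thesis using that w by blast
qed

lemma linear_bipositive_le_iff:
  assumes "linear i" "bipositive i"
  shows "i x \<le> i y \<longleftrightarrow> x \<le> y"
proof -
  have "x \<le> y \<longleftrightarrow> 0 \<le> i (y - x)"
    using assms(2) unfolding bipositive_def by (metis diff_ge_0_iff_ge)
  then show ?thesis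
    by (simp add: linear_diff[OF assms(1)])
qed

text \<open>Let \<open>0 \<le> z \<le> i e\<close> and subtract from \<open>z\<close> the largest multiple of \<open>i e\<close> below it. A nonzero
  rest would dominate some \<open>i y > 0\<close>; then \<open>0 < y \<le> e\<close>, so \<open>i y\<close> is a positive multiple of
  \<open>i e\<close>, contradicting maximality.\<close>

lemma bipositive_pervasive_atom_image:
  fixes i :: "'f::archimedean_riesz_space \<Rightarrow> 'd::archimedean_riesz_space"
  assumes lin: "linear i" and bip: "bipositive i" and perv: "is_pervasive (range i)"
    and atom: "atom e" and e: "0 < e"
  shows "atom (i e)"
proof -
  note le_iff = linear_bipositive_le_iff[OF lin bip]
  note i0 = linear_0[OF lin]
  have pos_iff: "0 < i x \<longleftrightarrow> 0 < x" for x
    using le_iff[of 0 x] le_iff[of x 0] by (simp add: i0 less_le_not_le)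
  have a: "0 < i e" using e pos_iff by simp
  have "\<exists>c. z = c *\<^sub>R i e" if z: "0 \<le> z" "z \<le> i e" for z
  proof -
    define c where "c = coefficient (i e) z"
    note c_iff = scaleR_le_iff_le_coefficient[OF a z(1), folded c_def]
    have c_le: "c *\<^sub>R i e \<le> z" by (simp add: c_iff)
    have c0: "0 \<le> c" unfolding c_def by (rule coefficient_nonneg[OF a z(1)])
    have "z = c *\<^sub>R i e"
    proof (rule ccontr)
      assume "z \<noteq> c *\<^sub>R i e"
      then have "0 < z - c *\<^sub>R i e" using c_le by (simp add: less_le)
      then obtain y where y: "0 < i y" "i y \<le> z - c *\<^sub>R i e"
        using perv unfolding is_pervasive_def by blast
      have "0 \<le> c *\<^sub>R i e" using c0 a by (simp add: scaleR_nonneg_nonneg)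
      then have "z - c *\<^sub>R i e \<le> z" by simp
      then have "i y \<le> i e" using y(2) z(2) by (meson order_trans)
      then have "y \<le> e" "0 \<le> y" using y(1) le_iff pos_iff by (simp_all add: less_imp_le)
      then obtain m where m: "y = m *\<^sub>R e" using atom unfolding atom_def by blast
      have "(c + m) *\<^sub>R i e \<le> z"
        using y(2) by (simp add: m linear_scale[OF lin] algebra_simps)
      then have "m \<le> 0" by (simp add: c_iff)
      then have "m *\<^sub>R e \<le> 0" using scaleR_right_mono[of m 0 e] e by simp
      then show False using m y(1) pos_iff[of y] by simp
    qed
    then show ?thesis ..
  qed
  then show ?thesis unfolding atom_def using a by (simp add: less_imp_le)
qed

section \<open>Regular operators into the completion\<close>

lemma linear_eq_0_if_eq_0_on_positive_cone:
  fixes T :: "'a::riesz_space \<Rightarrow> 'b::real_vector"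
  assumes lin: "linear T" and zero: "\<And>x. 0 \<le> x \<Longrightarrow> T x = 0"
  shows "T = (\<lambda>_. 0)"
proof
  fix x
  have "T x = T (pprt x) - T (- nprt x)"
    by (simp add: linear_diff[OF lin, symmetric] prts[symmetric])
  then show "T x = 0" by (simp add: zero)
qed

theorem proposition3p4:
  fixes i :: "'f::archimedean_riesz_space \<Rightarrow> 'd::order_complete_riesz_space"
  assumes "order_completion i"
    and "atomic TYPE('f)"
  shows "\<forall>T \<in> (regular_operators UNIV :: ('e::archimedean_riesz_space \<Rightarrow> 'd) set).
           op_less (\<lambda>_. 0) T \<longrightarrow>
             (\<exists>S \<in> regular_operators (range i). op_less (\<lambda>_. 0) S \<and> op_le S T)"
proof (intro ballI impI)
  fix T :: "'e \<Rightarrow> 'd"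
  assume regular: "T \<in> regular_operators UNIV" and less: "op_less (\<lambda>_. 0) T"
  have lin: "linear i" and bip: "bipositive i" and perv: "is_pervasive (range i)"
    using assms(1) unfolding order_completion_def by blast+
  note i0 = linear_0[OF lin]
  have linT: "linear T"
    using regular unfolding regular_operators_def positive_operator_def
    by (auto intro: linear_compose_sub)
  have posT: "0 \<le> T x" if "0 \<le> x" for x
    using less that unfolding op_less_def op_le_def by blast
  obtain x0 where x0: "0 \<le> x0" "T x0 \<noteq> 0"
    using linear_eq_0_if_eq_0_on_positive_cone[OF linT] less unfolding op_less_def by metis
  then have "0 < T x0" using posT by (simp add: less_le)
  then obtain y where y: "0 < i y" "i y \<le> T x0"
    using perv unfolding is_pervasive_def by blast
  have y0: "0 < y"
    using y(1) bip i0 unfolding bipositive_def by (metis less_le)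
  obtain w where w: "atom w" "0 < w" "w \<le> y"
    using atomic_positive_atom_below[OF assms(2) y0] .
  have iw_le: "i w \<le> T x0"
    using w(3) y(2) linear_bipositive_le_iff[OF lin bip] by (meson order_trans)
  have iw: "0 < i w"
    using linear_bipositive_le_iff[OF lin bip, of 0 w] linear_bipositive_le_iff[OF lin bip, of w 0]
      w(2) by (simp add: i0 less_le_not_le)
  obtain \<phi> where \<phi>: "linear \<phi>" "\<And>z. 0 \<le> z \<Longrightarrow> 0 \<le> \<phi> z" "\<And>z. 0 \<le> z \<Longrightarrow> \<phi> z *\<^sub>R i w \<le> z"
    and \<phi>_max: "\<And>t z. 0 \<le> z \<Longrightarrow> t *\<^sub>R i w \<le> z \<Longrightarrow> t \<le> \<phi> z"
    using atom_functional_exists[OF bipositive_pervasive_atom_image[OF lin bip perv w(1,2)] iw]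
    by blast
  define S where "S = (\<lambda>x. \<phi> (T x) *\<^sub>R i w)"
  have "linear S"
    unfolding S_def
    by (rule linearI)
      (simp_all add: linear_add[OF linT] linear_add[OF \<phi>(1)] linear_scale[OF linT]
        linear_scale[OF \<phi>(1)] scaleR_add_left)
  moreover have posS: "0 \<le> S x" if "0 \<le> x" for x
    unfolding S_def using \<phi>(2) posT that iw by (simp add: scaleR_nonneg_nonneg)
  ultimately have "positive_operator S"
    unfolding positive_operator_def by blast
  moreover have "range S \<subseteq> range i"
    unfolding S_def by (auto simp: linear_scale[OF lin, symmetric])
  moreover have "positive_operator (\<lambda>_::'e. 0::'d)"
    unfolding positive_operator_def by (simp add: linear_zero)
  moreover have "range (\<lambda>_::'e. 0::'d) \<subseteq> range i"
    using i0 by (auto intro: range_eqI[of _ _ 0])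
  moreover have "S = (\<lambda>x. S x - 0)" by simp
  ultimately have "S \<in> regular_operators (range i)"
    unfolding regular_operators_def by blast
  moreover have "op_less (\<lambda>_. 0) S"
  proof -
    have "1 \<le> \<phi> (T x0)"
      using \<phi>_max[of "T x0" 1] iw_le posT x0(1) by simp
    then have "S x0 \<noteq> 0"
      unfolding S_def using iw by auto
    then show ?thesis
      unfolding op_less_def op_le_def using posS by auto
  qed
  moreover have "op_le S T"
    unfolding op_le_def S_def using \<phi>(3) posT by blast
  ultimately show "\<exists>S \<in> regular_operators (range i). op_less (\<lambda>_. 0) S \<and> op_le S T"
    by blast
qed

end
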